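(* Let $\mathbb{F}_q$ be an arbitrary finite field and $s$ a prime dividing $q-1$. Moreover let $c\in\mathbb{F}_q$. Then for all $n\ge 2$, $$|T_c(n)|-(s-1)\,|U_c(n)|=\begin{cases}0, & \text{if } s\nmid n,\\ |T_c(n/s)|, & \text{if } s\mid n.\end{cases}$$
   Context: $\mathbb{F}_q$ is the finite field with $q$ elements and $\mathcal{I}_q^n$ denotes the set of monic irreducible polynomials of degree $n$ in $\mathbb{F}_q[x]$. For a prime $s$ dividing $q-1$, an element $c\in\mathbb{F}_q$ and a positive integer $n$, define $$T_c(n):=\left\{f\in\mathcal{I}_q^n\mid f(c)^{\frac{q-1}{s}}\neq(-1)^{\frac{(q-1)n}{s}}\right\},$$ $$U_c(n):=\mathcal{I}_q^n\setminus T_c(n)=\left\{f\in\mathcal{I}_q^n\mid f(c)^{\frac{q-1}{s}}=(-1)^{\frac{(q-1)n}{s}}\right\}.$$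
   Formalization: For n = s the right-hand side is |T_c(1)| − 1 instead of |T_c(1)|, since x − c lies in T_c(1) and must not be counted; the printed value fails e.g. for q = 3, s = n = 2, c = 0 (left side 1, |T_0(1)| = 2). *)

theory Defs
  imports "HOL-Computational_Algebra.Computational_Algebra" "HOL-Library.Cardinality"
begin

text \<open>
  The field with \<open>q\<close> elements is a type \<open>'a :: {field, finite}\<close> with \<open>q = CARD('a)\<close>.
\<close>

definition monic_irreducibles :: "nat \<Rightarrow> 'a::field poly set" where
  "monic_irreducibles n = {f. lead_coeff f = 1 \<and> irreducible f \<and> degree f = n}"

text \<open>
  Both divisions by \<open>s\<close> below are exact whenever \<open>s\<close> divides \<open>q - 1\<close>.
  There is no condition \<open>f(c) \<noteq> 0\<close> in \<open>T_set\<close>: for \<open>n = 1\<close> the polynomial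
  \<open>x - c\<close> is an element of it. An irreducible polynomial of degree at least 2 has no root,
  so this only matters for \<open>n = 1\<close>.
\<close>

definition T_set :: "nat \<Rightarrow> 'a::{field,finite} \<Rightarrow> nat \<Rightarrow> 'a poly set" where
  "T_set s c n = {f \<in> monic_irreducibles n.
     poly f c ^ ((CARD('a) - 1) div s) \<noteq> (- 1) ^ ((CARD('a) - 1) * n div s)}"

definition U_set :: "nat \<Rightarrow> 'a::{field,finite} \<Rightarrow> nat \<Rightarrow> 'a poly set" where
  "U_set s c n = monic_irreducibles n - T_set s c n"

lemma U_set_eq:
  fixes c :: "'a::{field,finite}"
  shows "U_set s c n = {f \<in> monic_irreducibles n.
     poly f c ^ ((CARD('a) - 1) div s) = (- 1) ^ ((CARD('a) - 1) * n div s)}"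
  by (auto simp: U_set_def T_set_def)

text \<open>
  In the counting theorem the case \<open>n = s\<close> is separate because of \<open>x - c \<in> T_set s c 1\<close>:
  this element has to be left out of the count, so the value is \<open>card (T_set s c 1) - 1\<close>.
  For example, for \<open>q = 3\<close>, \<open>s = n = 2\<close> and \<open>c = 0\<close> one has
  \<open>T_set s c 2 = {x\<^sup>2 + x + 2, x\<^sup>2 + 2 x + 2}\<close>, \<open>U_set s c 2 = {x\<^sup>2 + 1}\<close> and
  \<open>T_set s c 1 = {x, x + 1}\<close>, so the difference is 1 and not 2.
\<close>

end

theory Submission
  imports Defs
begin

text \<open>
  Put \<open>e = (q - 1) / s\<close> and \<open>v f = (-1)\<^bsup>deg f\<^esup> f(c)\<close>, which is multiplicative; membership in
  \<open>T_set\<close> means \<open>(v f)\<^bsup>e\<^esup> \<noteq> 1\<close>. Let \<open>W x\<close> be \<open>0\<close> for \<open>x = 0\<close>, \<open>1 - s\<close> if \<open>x\<^bsup>e\<^esup> = 1\<close> and \<open>1\<close>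
  otherwise (the negative of the sum of the nontrivial characters of order \<open>s\<close>). Since \<open>W\<close> and all
  its dilates sum to zero over the field, \<open>W (b * v f)\<close> sums to zero over the monic \<open>f\<close> of any
  positive degree. Weighting this sum with \<open>deg f = \<Sum> deg P\<close>, where \<open>P\<^bsup>k\<^esup>\<close> runs over the prime powers
  dividing \<open>f\<close>, leaves only the prime powers of degree exactly \<open>n\<close>, whence
  \<open>\<Sum>d | n. d * (\<Sum>P of degree d. W ((v P)\<^bsup>n/d\<^esup>)) = 0\<close>. This is the logarithmic derivative of the
  statement that the L-functions involved equal 1. Comparing the divisor sums for \<open>n\<close> and \<open>n / s\<close>
  gives the theorem by induction on \<open>n\<close>.
\<close>

section \<open>Monic polynomials over a finite field\<close>

definition monics :: "nat \<Rightarrow> 'a::field poly set" where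
  "monics n = {f. lead_coeff f = 1 \<and> degree f = n}"

lemma finite_degree_le: "finite {f :: 'a::{field,finite} poly. degree f \<le> n}"
proof (induction n)
  case 0
  have "{f :: 'a poly. degree f \<le> 0} \<subseteq> range (\<lambda>a. [:a:])"
    by (auto elim!: degree_eq_zeroE)
  then show ?case
    by (rule finite_subset) simp
next
  case (Suc n)
  have "{f :: 'a poly. degree f \<le> Suc n} \<subseteq> (\<lambda>(a, g). pCons a g) ` (UNIV \<times> {f. degree f \<le> n})"
  proof
    fix f :: "'a poly"
    assume f: "f \<in> {f. degree f \<le> Suc n}"
    obtain a g where "f = pCons a g"
      by (cases f) auto
    with f show "f \<in> (\<lambda>(a, g). pCons a g) ` (UNIV \<times> {f. degree f \<le> n})"
      by (auto simp: degree_pCons_eq_if split: if_splits)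
  qed
  then show ?case
    by (rule finite_subset) (use Suc in simp)
qed

lemma finite_monics: "finite (monics n :: 'a::{field,finite} poly set)"
  by (rule finite_subset[OF _ finite_degree_le[of n]]) (auto simp: monics_def)

lemma finite_monic_irreducibles: "finite (monic_irreducibles n :: 'a::{field,finite} poly set)"
  by (rule finite_subset[OF _ finite_degree_le[of n]]) (auto simp: monic_irreducibles_def)

lemma monics_0: "monics 0 = {1}"
  by (auto simp: monics_def elim!: degree_eq_zeroE)

lemma monic_irreducibles_0: "monic_irreducibles 0 = {}"
  by (auto simp: monic_irreducibles_def elim!: degree_eq_zeroE simp: irreducible_def one_pCons)

lemma degree_mult_monic:
  fixes f g :: "'a::field poly"
  assumes "lead_coeff f = 1" "lead_coeff g = 1"
  shows "degree (f * g) = degree f + degree g"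
  using assms by (metis degree_mult_eq leading_coeff_0_iff zero_neq_one)

lemma lead_coeff_mult_monic:
  fixes f g :: "'a::field poly"
  assumes "lead_coeff f = 1"
  shows "lead_coeff (f * g) = lead_coeff g"
  using assms by (simp add: lead_coeff_mult)

lemma monics_power:
  fixes P :: "'a::field poly"
  assumes "P \<in> monics d"
  shows "P ^ k \<in> monics (k * d)"
proof -
  have "P \<noteq> 0"
    using assms by (auto simp: monics_def)
  then show ?thesis
    using assms lead_coeff_power[of P k] by (auto simp: monics_def degree_power_eq)
qed

lemma monic_eq_associated:
  fixes P Q :: "'a::field poly"
  assumes P: "lead_coeff P = 1" "irreducible P" and Q: "lead_coeff Q = 1" "irreducible Q"
    and "P dvd Q"
  shows "P = Q"
proof -
  obtain g where g: "Q = P * g"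
    using \<open>P dvd Q\<close> by blast
  then have "g dvd 1"
    using irreducibleD[OF Q(2) g] irreducible_not_unit[OF P(2)] by blast
  moreover have "lead_coeff g = 1"
    using Q(1) lead_coeff_mult_monic[OF P(1), of g] g by simp
  ultimately have "g = 1"
    by (auto simp: is_unit_poly_iff)
  with g show ?thesis
    by simp
qed

lemma monic_irreducible_factor:
  fixes f :: "'a::field poly"
  assumes "lead_coeff f = 1" "degree f > 0"
  obtains P g where "P \<in> monic_irreducibles (degree P)" "lead_coeff g = 1" "f = P * g"
proof -
  have "\<exists>P. lead_coeff P = 1 \<and> irreducible P \<and> P dvd f"
    using assms
  proof (induction "degree f" arbitrary: f rule: less_induct)
    case less
    show ?case
    proof (cases "irreducible f")
      case False
      have nz: "f \<noteq> 0"
        using less.prems by auto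
      obtain a b where ab: "f = a * b" "\<not> a dvd 1" "\<not> b dvd 1"
        using False less.prems nz unfolding irreducible_def
        by (metis is_unit_iff_degree neq0_conv)
      then have a0: "a \<noteq> 0" and b0: "b \<noteq> 0"
        using nz by auto
      \<comment> \<open>The induction hypothesis speaks of monic polynomials, so the proper factor
        is rescaled; divisibility of \<open>f\<close> is unaffected.\<close>
      define a' where "a' = smult (inverse (lead_coeff a)) a"
      have "degree a' > 0" "degree a' < degree f" "lead_coeff a' = 1"
        using ab a0 b0 by (auto simp: a'_def is_unit_iff_degree degree_mult_eq)
      then obtain P where P: "lead_coeff P = 1 \<and> irreducible P \<and> P dvd a'"
        using less.hyps by blast
      moreover have "a' dvd f"
        using ab a0 by (auto simp: a'_def smult_dvd_iff)
      ultimately show ?thesis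
        by (meson dvd_trans)
    qed (use less.prems in auto)
  qed
  then obtain P g where P: "lead_coeff P = 1" "irreducible P" "f = P * g"
    by blast
  then show ?thesis
    using that[of P g] assms lead_coeff_mult_monic[of P g] by (auto simp: monic_irreducibles_def)
qed

section \<open>Prime powers dividing a monic polynomial\<close>

lemma prime_elem_power_dvd_mult_cancel:
  fixes P Q g :: "'a::idom"
  assumes "prime_elem P" "\<not> P dvd Q"
  shows "P ^ k dvd Q * g \<longleftrightarrow> P ^ k dvd g"
proof
  show "P ^ k dvd g" if "P ^ k dvd Q * g"
    using that
  proof (induction k)
    case (Suc k)
    then have "P ^ k dvd g"
      by (metis dvd_mult_right power_Suc2 dvd_mult_left)
    then obtain h where h: "g = P ^ k * h"
      by blast
    have "P ^ k * P dvd P ^ k * (Q * h)"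
      using Suc.prems h by (simp add: mult_ac)
    then have "P dvd Q * h"
      using assms(1) by (subst (asm) dvd_mult_cancel_left) auto
    then have "P dvd h"
      using assms prime_elem_dvd_multD by blast
    then show ?case
      using h by (simp add: mult_dvd_mono mult.commute)
  qed simp
qed simp

text \<open>The polynomial analogue of summing the von Mangoldt function over divisors. Splitting
  off one irreducible factor \<open>Q\<close> adds a single prime power of \<open>Q\<close>, hence
  \<open>degree Q\<close>. The common cutoff \<open>N\<close> loses nothing, since
  \<open>P ^ k dvd f\<close> bounds both \<open>k\<close> and \<open>degree P\<close> by
  \<open>degree f\<close>.\<close>

lemma sum_degree_prime_powers:
  fixes f :: "'a::{field,finite} poly"
  assumes "lead_coeff f = 1" "degree f \<le> N"
  shows "(\<Sum>d=1..N. \<Sum>P\<in>monic_irreducibles d. \<Sum>k=1..N. if P ^ k dvd f then d else 0) = degree f"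
  using assms
proof (induction "degree f" arbitrary: f rule: less_induct)
  case less
  show ?case
  proof (cases "degree f = 0")
    case True
    then have f: "f = 1"
      using less.prems monics_0 unfolding monics_def by blast
    have "\<not> P ^ k dvd f" if "P \<in> monic_irreducibles d" "k \<in> {1..N}" for P :: "'a poly" and d k
      using that f by (auto simp: monic_irreducibles_def is_unit_power_iff irreducible_def)
    then show ?thesis
      using True by simp
  next
    case False
    then obtain Q g where Q: "Q \<in> monic_irreducibles (degree Q)" and g: "lead_coeff g = 1"
      and f: "f = Q * g"
      using monic_irreducible_factor less.prems(1) by blast
    have Q': "lead_coeff Q = 1" "irreducible Q" "prime_elem Q" "Q \<noteq> 0"
      using Q by (auto simp: monic_irreducibles_def field_poly_irreducible_imp_prime)
    have dQ: "degree Q > 0"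
      using Q by (metis monic_irreducibles_0 empty_iff gr0I)
    have df: "degree f = degree Q + degree g"
      unfolding f by (rule degree_mult_monic[OF Q'(1) g])
    have QN: "degree Q \<in> {1..N}"
      using dQ df less.prems by auto
    have *: "(\<Sum>k=1..N. if P ^ k dvd f then d else 0) =
        (\<Sum>k=1..N. if P ^ k dvd g then d else 0) + (if P = Q then d else 0)"
      if P: "P \<in> monic_irreducibles d" for P d
    proof (cases "P = Q")
      case True
      \<comment> \<open>Since \<open>degree g < N\<close>, the exponent \<open>N\<close> is out of
        reach for \<open>g\<close>. So the terms for \<open>f\<close> are those for \<open>g\<close>
        shifted by one, and the new term \<open>k = 0\<close> contributes the extra
        \<open>d\<close>.\<close>
      have "\<not> Q ^ N dvd g"
      proof
        assume "Q ^ N dvd g"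
        moreover have "g \<noteq> 0"
          using g by auto
        ultimately have "N * degree Q \<le> degree g"
          using dvd_imp_degree_le[of "Q ^ N" g] Q' by (simp add: degree_power_eq)
        moreover have "N \<le> N * degree Q"
          using dQ by simp
        ultimately show False
          using df dQ less.prems by linarith
      qed
      then have "(\<Sum>k=1..N. if Q ^ k dvd g then d else 0) = (\<Sum>k=1..<N. if Q ^ k dvd g then d else 0)"
        by (intro sum.mono_neutral_right) (auto simp: le_less)
      moreover have "(\<Sum>k=1..N. if Q ^ k dvd f then d else 0) = (\<Sum>k=0..<N. if Q ^ k dvd g then d else 0)"
        unfolding f using Q'(4)
        by (intro sum.reindex_bij_witness[of _ Suc "\<lambda>k. k - 1"]) (auto simp: power_eq_if)
      moreover have "0 < N"
        using QN by simp
      ultimately show ?thesis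
        using True by (simp add: sum.atLeast_Suc_lessThan)
    next
      case False
      have "prime_elem P" "\<not> P dvd Q"
        using P False monic_eq_associated[of P Q] Q'
        by (auto simp: monic_irreducibles_def field_poly_irreducible_imp_prime)
      then show ?thesis
        using False by (simp add: f prime_elem_power_dvd_mult_cancel)
    qed
    have "(\<Sum>P\<in>monic_irreducibles d. if P = Q then d else 0) = (if d = degree Q then d else 0)" for d
    proof -
      have "(\<Sum>P\<in>monic_irreducibles d. if P = Q then d else 0) = (if Q \<in> monic_irreducibles d then d else 0)"
        by (simp add: finite_monic_irreducibles)
      then show ?thesis
        using Q by (auto simp: monic_irreducibles_def)
    qed
    then have "(\<Sum>d=1..N. \<Sum>P\<in>monic_irreducibles d. if P = Q then d else 0) = degree Q"
      using QN by simp
    moreover have "(\<Sum>d=1..N. \<Sum>P\<in>monic_irreducibles d. \<Sum>k=1..N. if P ^ k dvd g then d else 0) = degree g"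
      using less.hyps[of g] g df dQ less.prems by simp
    ultimately show ?thesis
      using df * by (simp add: sum.distrib cong: sum.cong_simp)
  qed
qed

section \<open>Twisted sums over monic polynomials\<close>

lemma sum_monics_dvd:
  fixes h :: "'a::{field,finite} poly \<Rightarrow> int"
  assumes D: "D \<in> monics m"
  shows "(\<Sum>f\<in>monics n. if D dvd f then h f else 0) = (if m \<le> n then \<Sum>g\<in>monics (n - m). h (D * g) else 0)"
proof -
  have D': "lead_coeff D = 1" "degree D = m" "D \<noteq> 0"
    using D by (auto simp: monics_def)
  have lc: "lead_coeff g = 1 \<and> degree (D * g) = m + degree g" if "lead_coeff (D * g) = 1" for g
    using that lead_coeff_mult_monic[OF D'(1), of g] degree_mult_monic[OF D'(1), of g] D'(2) by simp
  show ?thesis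
  proof (cases "m \<le> n")
    case True
    have "{f \<in> monics n. D dvd f} = (\<lambda>g. D * g) ` monics (n - m)"
      using True lc D' lead_coeff_mult_monic[OF D'(1)] degree_mult_monic[OF D'(1)]
      by (fastforce simp: monics_def)
    moreover have "inj_on (\<lambda>g. D * g) (monics (n - m))"
      using D'(3) by (auto simp: inj_on_def)
    ultimately show ?thesis
      using True by (simp add: sum.inter_filter[symmetric] finite_monics sum.reindex)
  next
    case False
    then have "\<not> D dvd f" if "f \<in> monics n" for f
      using that lc by (force simp: monics_def)
    then show ?thesis
      using False by simp
  qed
qed

text \<open>
  The hypothesis \<open>zero\<close> says that the twisted L-function attached to \<open>W\<close> is constant.
\<close>

lemma sum_prime_powers_eq_0:
  fixes W :: "'a::{field,finite} \<Rightarrow> int" and v :: "'a poly \<Rightarrow> 'a"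
  assumes mult: "\<And>f g. lead_coeff f = 1 \<Longrightarrow> lead_coeff g = 1 \<Longrightarrow> v (f * g) = v f * v g"
    and one: "v 1 = 1"
    and zero: "\<And>b m. m > 0 \<Longrightarrow> (\<Sum>f\<in>monics m. W (b * v f)) = 0"
    and n: "n > 0"
  shows "(\<Sum>d | d dvd n. int d * (\<Sum>P\<in>monic_irreducibles d. W (v P ^ (n div d)))) = 0"
proof -
  have vpow: "v (P ^ k) = v P ^ k" if "lead_coeff P = 1" for P k
    using that by (induction k) (auto simp: one mult lead_coeff_power)
  \<comment> \<open>After writing \<open>f = P ^ k * g\<close>, the sum over cofactors of positive
    degree vanishes by \<open>zero\<close> with \<open>b = v (P ^ k)\<close>. Only
    \<open>g = 1\<close> can survive, which forces \<open>P ^ k\<close> to have degree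
    \<open>n\<close>.\<close>
  have inner: "(\<Sum>f\<in>monics n. if P ^ k dvd f then W (v f) else 0) =
      (if k * d = n then W (v P ^ k) else 0)" if P: "P \<in> monic_irreducibles d" for P d k
  proof -
    have P': "lead_coeff P = 1" "P \<in> monics d"
      using P by (auto simp: monic_irreducibles_def monics_def)
    have Pk: "lead_coeff (P ^ k) = 1"
      using P' by (simp add: lead_coeff_power)
    have "(\<Sum>g\<in>monics m. W (v (P ^ k * g))) = (\<Sum>g\<in>monics m. W (v (P ^ k) * v g))" for m
      using Pk by (intro sum.cong refl arg_cong[of _ _ W] mult) (auto simp: monics_def)
    then have "(\<Sum>g\<in>monics m. W (v (P ^ k * g))) = (if m = 0 then W (v P ^ k) else 0)" for m
      by (auto simp: zero monics_0 one vpow[OF P'(1)])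
    then show ?thesis
      unfolding sum_monics_dvd[OF monics_power[OF P'(2)]] by auto
  qed
  have ksum: "(\<Sum>k=1..n. if k * d = n then w k else (0::int)) = (if d dvd n then w (n div d) else 0)"
    if "d \<in> {1..n}" for d w
  proof -
    have "(\<Sum>k=1..n. if k * d = n then w k else 0) =
        (\<Sum>k=1..n. if k = n div d then if d dvd n then w (n div d) else 0 else 0)"
      using that by (intro sum.cong refl) auto
    also have "\<dots> = (if d dvd n then w (n div d) else 0)"
      using that n by (auto simp: Suc_le_eq div_greater_zero_iff)
    finally show ?thesis .
  qed
  \<comment> \<open>The factor \<open>n\<close> is read as \<open>degree f\<close> and expanded over
    the prime powers dividing \<open>f\<close>; exchanging sums then isolates the multiples of each
    \<open>P ^ k\<close>, to which \<open>inner\<close> applies.\<close>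
  have "0 = int n * (\<Sum>f\<in>monics n. W (1 * v f))"
    using zero[OF n, of 1] by simp
  also have "\<dots> = (\<Sum>f\<in>monics n. int (degree f) * W (v f))"
    by (simp add: sum_distrib_left monics_def)
  also have "\<dots> = (\<Sum>f\<in>monics n. int (\<Sum>d=1..n. \<Sum>P\<in>monic_irreducibles d. \<Sum>k=1..n. if P ^ k dvd f then d else 0) * W (v f))"
    by (intro sum.cong refl) (subst sum_degree_prime_powers, auto simp: monics_def)
  also have "\<dots> = (\<Sum>f\<in>monics n. \<Sum>d=1..n. \<Sum>P\<in>monic_irreducibles d. \<Sum>k=1..n. int d * (if P ^ k dvd f then W (v f) else 0))"
    by (simp add: sum_distrib_right if_distrib[of int] if_distrib[of "\<lambda>x. x * _"] if_distrib[of "\<lambda>x. _ * x"] cong: if_cong)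
  also have "\<dots> = (\<Sum>d=1..n. \<Sum>f\<in>monics n. \<Sum>P\<in>monic_irreducibles d. \<Sum>k=1..n. int d * (if P ^ k dvd f then W (v f) else 0))"
    by (rule sum.swap)
  also have "\<dots> = (\<Sum>d=1..n. \<Sum>P\<in>monic_irreducibles d. \<Sum>f\<in>monics n. \<Sum>k=1..n. int d * (if P ^ k dvd f then W (v f) else 0))"
    by (intro sum.cong refl sum.swap)
  also have "\<dots> = (\<Sum>d=1..n. \<Sum>P\<in>monic_irreducibles d. \<Sum>k=1..n. \<Sum>f\<in>monics n. int d * (if P ^ k dvd f then W (v f) else 0))"
    by (intro sum.cong refl sum.swap)
  also have "\<dots> = (\<Sum>d=1..n. \<Sum>P\<in>monic_irreducibles d. int d * (\<Sum>k=1..n. if k * d = n then W (v P ^ k) else 0))"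
    by (intro sum.cong refl) (simp add: sum_distrib_left[symmetric] inner)
  also have "\<dots> = (\<Sum>d=1..n. if d dvd n then int d * (\<Sum>P\<in>monic_irreducibles d. W (v P ^ (n div d))) else 0)"
    by (intro sum.cong refl) (simp only: ksum, simp add: sum_distrib_left)
  also have "\<dots> = (\<Sum>d\<in>{d \<in> {1..n}. d dvd n}. int d * (\<Sum>P\<in>monic_irreducibles d. W (v P ^ (n div d))))"
    by (rule sum.inter_filter[symmetric]) simp
  also have "{d \<in> {1..n}. d dvd n} = {d. d dvd n}"
    using n by (auto simp: Suc_le_eq dvd_pos_nat dvd_imp_le)
  finally show ?thesis
    by simp
qed

section \<open>Power residues in a finite field\<close>

text \<open>Multiplication by \<open>a\<close> permutes the nonzero elements, so their nonzero
  product absorbs the factor \<open>a ^ (q - 1)\<close>.\<close>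

lemma power_card_minus_1:
  fixes a :: "'a::{field,finite}"
  assumes "a \<noteq> 0"
  shows "a ^ (CARD('a) - 1) = 1"
proof -
  have "bij_betw (\<lambda>x. a * x) (- {0}) (- {0})"
    using assms by (intro bij_betw_byWitness[of _ "\<lambda>x. x / a"]) auto
  then have "(\<Prod>x\<in>- {0}. a * x) = (\<Prod>x\<in>- {0 :: 'a}. x)"
    by (rule prod.reindex_bij_betw)
  moreover have "card (- {0 :: 'a}) = CARD('a) - 1"
    by (simp add: Compl_eq_Diff_UNIV card_Diff_singleton)
  moreover have "(\<Prod>x\<in>- {0 :: 'a}. x) \<noteq> 0"
    by simp
  ultimately show ?thesis
    by (simp add: prod.distrib)
qed

text \<open>With \<open>q - 1 = e * k\<close>, the polynomial \<open>x ^ (q - 1) - 1\<close> factors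
  as \<open>A * B\<close> and vanishes at all \<open>q - 1\<close> nonzero elements. At most
  \<open>e * (k - 1)\<close> of them are roots of \<open>B\<close>, which leaves at least
  \<open>e\<close> for \<open>A = x ^ e - 1\<close>.\<close>

lemma card_roots_of_unity:
  assumes dvd: "e dvd CARD('a::{field,finite}) - 1"
  shows "card {x :: 'a. x ^ e = 1} = e"
proof -
  let ?q = "CARD('a)"
  have q: "?q > 1"
    using card_mono[of UNIV "{0, 1 :: 'a}"] by simp
  obtain k where k: "?q - 1 = e * k"
    using dvd by blast
  with q have e: "e > 0" and k0: "k > 0"
    by (auto intro: gr0I)
  define A :: "'a poly" where "A = monom 1 e - 1"
  define B :: "'a poly" where "B = (\<Sum>i<k. monom 1 (e * i))"
  have "coeff A e = 1"
    using e by (simp add: A_def)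
  then have A: "A \<noteq> 0"
    by auto
  have dA: "degree A \<le> e"
    unfolding A_def by (intro degree_diff_le) (auto simp: degree_monom_le)
  have AB: "poly A x * poly B x = x ^ (?q - 1) - 1" for x
    using power_diff_1_eq[of "x ^ e" k]
    unfolding k by (simp add: A_def B_def poly_monom poly_sum power_mult)
  \<comment> \<open>The constant term is 1, from \<open>i = 0\<close>; this shows
    \<open>B \<noteq> 0\<close>, as the root bound requires.\<close>
  have "coeff B 0 = (\<Sum>i<k. if i = 0 then 1 else 0)"
    using e by (simp add: B_def coeff_sum coeff_monom cong: if_cong)
  then have B: "B \<noteq> 0"
    using k0 by auto
  have dB: "degree B \<le> e * (k - 1)"
    unfolding B_def by (intro degree_sum_le) (auto intro!: order.trans[OF degree_monom_le])
  have "poly A x = 0 \<or> poly B x = 0" if "x \<noteq> 0" for x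
    using AB[of x] power_card_minus_1[OF that] by (simp flip: mult_eq_0_iff)
  then have "- {0} \<subseteq> {x. poly A x = 0} \<union> {x. poly B x = 0}"
    by auto
  then have "card (- {0 :: 'a}) \<le> card ({x. poly A x = 0} \<union> {x. poly B x = 0})"
    by (intro card_mono) auto
  also have "\<dots> \<le> card {x. poly A x = 0} + card {x. poly B x = 0}"
    by (rule card_Un_le)
  also have "\<dots> \<le> card {x. poly A x = 0} + e * (k - 1)"
    using card_poly_roots_bound[OF B] dB by simp
  finally have "e * k \<le> card {x. poly A x = 0} + e * (k - 1)"
    using k by (simp add: Compl_eq_Diff_UNIV card_Diff_singleton)
  moreover have "e * k = e + e * (k - 1)"
    using k0 by (cases k) auto
  ultimately have "e \<le> card {x. poly A x = 0}"
    by linarith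
  moreover have "card {x. poly A x = 0} \<le> e"
    using card_poly_roots_bound[OF A] dA by simp
  moreover have "{x. poly A x = 0} = {x. x ^ e = 1}"
    by (auto simp: A_def poly_monom)
  ultimately show ?thesis
    by simp
qed

section \<open>The residue weight\<close>

definition res_weight :: "nat \<Rightarrow> 'a::{field,finite} \<Rightarrow> int" where
  "res_weight s x = (if x = 0 then 0
     else if x ^ ((CARD('a) - 1) div s) = 1 then 1 - int s else 1)"

text \<open>The \<open>e\<close> elements with \<open>x ^ e = 1\<close> have total weight
  \<open>e * (1 - s)\<close>, which cancels the \<open>(s - 1) * e\<close> other nonzero elements of
  weight 1. A nonzero dilation merely permutes the field.\<close>

lemma sum_res_weight:
  fixes b :: "'a::{field,finite}"
  assumes s: "s dvd CARD('a) - 1"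
  shows "(\<Sum>x\<in>UNIV. res_weight s (b * x)) = 0"
proof (cases "b = 0")
  case False
  define e where "e = (CARD('a) - 1) div s"
  have q: "CARD('a) > 1"
    using card_mono[of UNIV "{0, 1 :: 'a}"] by simp
  have es: "CARD('a) - 1 = s * e"
    using s by (simp add: e_def)
  then have e: "e > 0"
    using q by (auto intro: gr0I)
  have "bij_betw (\<lambda>x. b * x) UNIV UNIV"
    using False by (intro bij_betw_byWitness[of _ "\<lambda>x. x / b"]) auto
  then have "(\<Sum>x\<in>UNIV. res_weight s (b * x)) = (\<Sum>x\<in>UNIV. res_weight s (x :: 'a))"
    by (rule sum.reindex_bij_betw)
  \<comment> \<open>The weight is the indicator of nonzero elements minus \<open>s\<close> times the
    indicator of \<open>x ^ e = 1\<close>. Here \<open>e > 0\<close> keeps 0 out of the second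
    set.\<close>
  also have "\<dots> = (\<Sum>x\<in>UNIV. (1 - (if x = 0 then 1 else 0)) - int s * (if x \<in> {x :: 'a. x ^ e = 1} then 1 else 0))"
    using e by (intro sum.cong refl) (auto simp: res_weight_def e_def[symmetric] power_0_left simp del: One_nat_def)
  also have "\<dots> = int CARD('a) - 1 - int s * int (card {x :: 'a. x ^ e = 1})"
    by (simp add: sum_subtractf sum_distrib_left[symmetric] sum.If_cases del: mem_Collect_eq)
  also have "card {x :: 'a. x ^ e = 1} = e"
    using es by (intro card_roots_of_unity) simp
  also have "int CARD('a) - 1 - int s * int e = 0"
    using es q by (metis One_nat_def Suc_leI diff_self of_nat_1 of_nat_diff of_nat_mult order_less_imp_le)
  finally show ?thesis .
qed (simp add: res_weight_def)

text \<open>Adding a constant \<open>a\<close> permutes the monic polynomials of degree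
  \<open>m > 0\<close> and shifts their values at \<open>c\<close> by \<open>a\<close>. Averaging
  over all \<open>a\<close> turns each term into a full sum of \<open>F\<close>.\<close>

lemma sum_monics_poly_eq_0:
  fixes F :: "'a::{field,finite} \<Rightarrow> int" and c :: 'a
  assumes F: "(\<Sum>x\<in>UNIV. F x) = 0" and m: "m > 0"
  shows "(\<Sum>f\<in>monics m. F (poly f c)) = 0"
proof -
  have mon: "f + [:a:] \<in> monics m" if "f \<in> monics m" for f and a :: 'a
    using that m by (auto simp: monics_def degree_add_eq_left coeff_pCons split: nat.splits)
  have shift: "(\<Sum>f\<in>monics m. F (poly f c)) = (\<Sum>f\<in>monics m. F (poly f c + a))" for a
    using mon[of _ a] mon[of _ "- a"]
    by (intro sum.reindex_bij_witness[of _ "\<lambda>f. f + [:a:]" "\<lambda>f. f + [:- a:]"]) auto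
  have tr: "(\<Sum>a\<in>UNIV. F (b + a)) = 0" for b
    using F sum.reindex_bij_betw[OF bij_plus_right[of b], of F] by (simp add: add.commute)
  have "int CARD('a) * (\<Sum>f\<in>monics m. F (poly f c)) = (\<Sum>a\<in>UNIV. \<Sum>f\<in>monics m. F (poly f c + a))"
    using shift by simp
  also have "\<dots> = (\<Sum>f\<in>monics m. \<Sum>a\<in>UNIV. F (poly f c + a))"
    by (rule sum.swap)
  also have "\<dots> = 0"
    using tr by simp
  finally show ?thesis
    by simp
qed

text \<open>For \<open>x \<noteq> 0\<close>, \<open>y = x ^ e\<close> satisfies
  \<open>y ^ s = 1\<close>, so its order is 1 or the prime \<open>s\<close>. Taking a
  \<open>k\<close>-th power changes whether \<open>y\<close> is trivial only if
  \<open>s dvd k\<close> and \<open>y \<noteq> 1\<close>; the weight then drops from 1 to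
  \<open>1 - s\<close>.\<close>

lemma res_weight_power:
  fixes x :: "'a::{field,finite}"
  assumes "prime s" "s dvd CARD('a) - 1" "k > 0"
  shows "res_weight s (x ^ k) = res_weight s x -
    (if s dvd k \<and> x \<noteq> 0 \<and> x ^ ((CARD('a) - 1) div s) \<noteq> 1 then int s else 0)"
proof (cases "x = 0")
  case False
  define y where "y = x ^ ((CARD('a) - 1) div s)"
  have "y ^ s = 1"
    using assms(2) power_card_minus_1[OF False] by (simp add: y_def flip: power_mult)
  have 1: "y ^ k = 1" if "s dvd k"
    using that \<open>y ^ s = 1\<close> by (auto simp: power_mult elim!: dvdE)
  have 2: "y = 1" if "\<not> s dvd k" "y ^ k = 1"
  proof -
    have "coprime k s"
      using that(1) assms(1) prime_imp_coprime coprime_commute by blast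
    then obtain a b where ab: "k * a = s * b + 1"
      using that(1) assms(3) bezout_nat[of k s] by (auto simp: coprime_iff_gcd_eq_1)
    have "y ^ (k * a) = y ^ (s * b) * y"
      by (simp add: ab)
    then show ?thesis
      using that(2) \<open>y ^ s = 1\<close> by (simp add: power_mult)
  qed
  have "(x ^ k) ^ ((CARD('a) - 1) div s) = y ^ k"
    by (simp add: y_def mult.commute flip: power_mult)
  then show ?thesis
    using False 1 2 assms(3) by (auto simp: res_weight_def y_def[symmetric] simp del: One_nat_def)
qed (use assms in \<open>simp add: res_weight_def power_0_left\<close>)

section \<open>The counting theorem\<close>

theorem theorem17:
  fixes c :: "'a::{field,finite}" and s n :: nat
  assumes "prime s" and "s dvd CARD('a) - 1" and "n \<ge> 2"
  shows "int (card (T_set s c n)) - (int s - 1) * int (card (U_set s c n)) =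
    (if \<not> s dvd n then 0
     else if n = s then int (card (T_set s c 1)) - 1
     else int (card (T_set s c (n div s))))"
proof -
  define e where "e = (CARD('a) - 1) div s"
  define v :: "'a poly \<Rightarrow> 'a" where "v f = (- 1) ^ degree f * poly f c" for f
  \<comment> \<open>Polynomials vanishing at \<open>c\<close> have weight 0, so the weighted sums
    see only \<open>T'\<close>.\<close>
  define T' where "T' d = {P \<in> T_set s c d. poly P c \<noteq> 0}" for d
  define S where "S d = (\<Sum>P\<in>monic_irreducibles d. res_weight s (v P))" for d
  define t where "t d = int d * int (card (T' d))" for d
  have s0: "s > 0"
    using assms(1) by (rule prime_gt_0_nat)
  have q: "CARD('a) > 1"
    using card_mono[of UNIV "{0, 1 :: 'a}"] by simp
  have es: "CARD('a) - 1 = s * e"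
    using assms(2) by (simp add: e_def)
  then have e: "e > 0"
    using q by (auto intro: gr0I)
  have fin: "finite (T_set s c d)" for d
    by (rule finite_subset[OF _ finite_monic_irreducibles[of d]]) (auto simp: T_set_def)
  have ex: "(CARD('a) - 1) * d div s = e * d" for d
    unfolding es using s0 by (simp add: mult.assoc)
  \<comment> \<open>The sign \<open>(- 1) ^ (e * d)\<close> is its own inverse and can be moved
    across the equation.\<close>
  have v1: "v P ^ e = 1 \<longleftrightarrow> poly P c ^ e = (- 1) ^ (e * d)" if "degree P = d" for P d
  proof -
    have sq: "(- 1 :: 'a) ^ (e * d) * (- 1) ^ (e * d) = 1"
      by (simp flip: power_mult_distrib)
    have "v P ^ e = (- 1) ^ (e * d) * poly P c ^ e"
      using that by (simp add: v_def power_mult_distrib power_mult[symmetric] mult.commute)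
    with sq show ?thesis
      by (metis mult.assoc mult.right_neutral mult_1)
  qed
  have T': "P \<in> T' d \<longleftrightarrow> v P \<noteq> 0 \<and> v P ^ e \<noteq> 1" if "P \<in> monic_irreducibles d" for P d
    using that v1[of P d]
    by (auto simp: T'_def T_set_def ex monic_irreducibles_def v_def e_def[symmetric] simp del: One_nat_def)
  have U: "P \<in> U_set s c d \<longleftrightarrow> v P ^ e = 1" if "P \<in> monic_irreducibles d" for P d
    using that v1[of P d] by (auto simp: U_set_eq ex monic_irreducibles_def e_def[symmetric] simp del: One_nat_def)
  have sub: "T' d \<subseteq> monic_irreducibles d" "U_set s c d \<subseteq> monic_irreducibles d" for d
    by (auto simp: T'_def T_set_def U_set_def)
  have S: "S d = int (card (T' d)) - (int s - 1) * int (card (U_set s c d))" for d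
  proof -
    have "S d = (\<Sum>P\<in>monic_irreducibles d.
        (if P \<in> T' d then 1 else 0) - (int s - 1) * (if P \<in> U_set s c d then 1 else 0))"
      unfolding S_def using e
      by (intro sum.cong refl) (auto simp: T' U res_weight_def e_def[symmetric] power_0_left simp del: One_nat_def)
    also have "\<dots> = int (card (T' d)) - (int s - 1) * int (card (U_set s c d))"
      using sub[of d]
      by (simp add: sum_subtractf sum_distrib_left[symmetric] sum.inter_restrict[symmetric]
          finite_monic_irreducibles Int_absorb1)
    finally show ?thesis .
  qed
  \<comment> \<open>By \<open>res_weight_power\<close>, each element of \<open>T' d\<close> loses
    \<open>s\<close> when \<open>s dvd k\<close>, and all other weights are unchanged.\<close>
  have weighted: "(\<Sum>P\<in>monic_irreducibles d. res_weight s (v P ^ k)) =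
      S d - (if s dvd k then int s * int (card (T' d)) else 0)" if "k > 0" for d k
  proof -
    have "(\<Sum>P\<in>monic_irreducibles d. res_weight s (v P ^ k)) = (\<Sum>P\<in>monic_irreducibles d.
        res_weight s (v P) - (if s dvd k then int s else 0) * (if P \<in> T' d then 1 else 0))"
      by (intro sum.cong refl)
        (auto simp: T' res_weight_power[OF assms(1,2) that] e_def[symmetric] simp del: One_nat_def)
    also have "\<dots> = S d - (if s dvd k then int s * int (card (T' d)) else 0)"
      using sub[of d]
      by (simp add: S_def sum_subtractf sum_distrib_left[symmetric] sum.inter_restrict[symmetric]
          finite_monic_irreducibles Int_absorb1)
    finally show ?thesis .
  qed
  have zero: "(\<Sum>f\<in>monics m. res_weight s (b * v f)) = 0" if "m > 0" for b m
  proof -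
    have "(\<Sum>f\<in>monics m. res_weight s (b * v f)) =
        (\<Sum>f\<in>monics m. res_weight s (b * (- 1) ^ m * poly f c))"
      by (simp add: monics_def v_def mult.assoc)
    also have "\<dots> = 0"
      by (rule sum_monics_poly_eq_0[OF sum_res_weight[OF assms(2)] that])
    finally show ?thesis .
  qed
  have key: "(\<Sum>d | d dvd m. int d * S d) = (\<Sum>d | d dvd m. if s dvd d then int s * t (d div s) else 0)"
    if m: "m > 0" for m
  proof -
    have fd: "finite {d. d dvd m}"
      using m by simp
    have "0 = (\<Sum>d | d dvd m. int d * (\<Sum>P\<in>monic_irreducibles d. res_weight s (v P ^ (m div d))))"
      using zero m
      by (intro sum_prime_powers_eq_0[symmetric]) (auto simp: v_def degree_mult_monic power_add)
    also have "\<dots> = (\<Sum>d | d dvd m. int d * S d - (if s dvd m div d then int s * t d else 0))"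
      using m by (intro sum.cong refl)
        (auto simp: weighted t_def right_diff_distrib dvd_div_eq_0_iff)
    finally have "(\<Sum>d | d dvd m. int d * S d) = (\<Sum>d | d dvd m. if s dvd m div d then int s * t d else 0)"
      by (simp add: sum_subtractf)
    also have "\<dots> = (\<Sum>d\<in>{d \<in> {d. d dvd m}. s dvd m div d}. int s * t d)"
      by (rule sum.inter_filter[OF fd, symmetric])
    \<comment> \<open>The map \<open>d \<mapsto> s * d\<close> carries the divisors with
      \<open>s dvd m div d\<close> to those divisible by \<open>s\<close>. Both sides of
      \<open>key\<close> thereby run over the same divisors of \<open>m\<close>.\<close>
    also have "\<dots> = (\<Sum>d\<in>{d \<in> {d. d dvd m}. s dvd d}. int s * t (d div s))"
      using s0 m
      by (intro sum.reindex_bij_witness[of _ "\<lambda>d. d div s" "\<lambda>d. s * d"])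
        (auto elim!: dvdE simp: mult_ac)
    also have "\<dots> = (\<Sum>d | d dvd m. if s dvd d then int s * t (d div s) else 0)"
      by (rule sum.inter_filter[OF fd])
    finally show ?thesis .
  qed
  \<comment> \<open>Equal divisor sums for every \<open>m\<close> have equal terms: strong induction
    cancels the proper divisors, in place of Moebius inversion.\<close>
  have main: "int m * S m = (if s dvd m then int s * t (m div s) else 0)" if "m > 0" for m
    using that
  proof (induction m rule: less_induct)
    case (less m)
    have fd: "finite {d. d dvd m}"
      using less.prems by simp
    have "(\<Sum>d\<in>{d. d dvd m} - {m}. int d * S d) =
        (\<Sum>d\<in>{d. d dvd m} - {m}. if s dvd d then int s * t (d div s) else 0)"
    proof (rule sum.cong[OF refl])
      fix d
      assume "d \<in> {d. d dvd m} - {m}"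
      then have "d < m" "d > 0"
        using less.prems dvd_imp_le[of d m] dvd_pos_nat[of m d] by auto
      then show "int d * S d = (if s dvd d then int s * t (d div s) else 0)"
        by (rule less.IH)
    qed
    then show ?case
      using key[OF less.prems] by (simp add: sum.remove[OF fd, of m])
  qed
  \<comment> \<open>An irreducible polynomial with root \<open>c\<close> is divisible by
    \<open>x - c\<close>, hence equal to it if monic, and so has degree 1.\<close>
  have T'_eq: "T' d = T_set s c d" if "d \<ge> 2" for d
  proof -
    have "poly P c \<noteq> 0" if "P \<in> monic_irreducibles d" for P
    proof
      assume "poly P c = 0"
      then have "[:- c, 1:] dvd P"
        by (simp add: poly_eq_0_iff_dvd)
      then have "[:- c, 1:] = P"
        using that by (intro monic_eq_associated)
          (auto simp: monic_irreducibles_def intro!: irreducible_linear_field_poly)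
      with that \<open>d \<ge> 2\<close> show False
        by (auto simp: monic_irreducibles_def)
    qed
    then show ?thesis
      by (auto simp: T'_def T_set_def)
  qed
  \<comment> \<open>In degree 1, \<open>x - c\<close> lies in \<open>T_set\<close>, because
    \<open>0 ^ e = 0\<close> is not a sign, but it has weight 0. This is the 1 subtracted when
    \<open>n = s\<close>.\<close>
  have T'_1: "int (card (T' 1)) = int (card (T_set s c 1)) - 1"
  proof -
    have X: "[:- c, 1:] \<in> T_set s c 1"
      using e by (auto simp: T_set_def monic_irreducibles_def power_0_left e_def[symmetric]
          simp del: One_nat_def intro!: irreducible_linear_field_poly)
    have "P = [:- c, 1:]" if "P \<in> T_set s c 1" "poly P c = 0" for P
    proof -
      have "[:- c, 1:] dvd P"
        using that by (simp add: poly_eq_0_iff_dvd)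
      then show ?thesis
        using that X by (intro monic_eq_associated[symmetric])
          (auto simp: T_set_def monic_irreducibles_def)
    qed
    moreover have "poly [:- c, 1:] c = 0"
      by simp
    ultimately have "T' 1 = T_set s c 1 - {[:- c, 1:]}"
      unfolding T'_def by blast
    moreover have "card (T_set s c 1) > 0"
      using X fin card_gt_0_iff by blast
    ultimately show ?thesis
      using X by (simp add: card_Diff_singleton of_nat_diff Suc_leI)
  qed
  \<comment> \<open>For \<open>s dvd n\<close>, the factors \<open>s\<close> and
    \<open>n div s\<close> of \<open>s * t (n div s)\<close> combine to \<open>n\<close>, which then
    cancels.\<close>
  have "int n * S n = (if s dvd n then int n * int (card (T' (n div s))) else 0)"
    using main[of n] assms(3) by (auto simp: t_def mult.assoc[symmetric] simp flip: of_nat_mult)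
  then have Sn: "S n = (if s dvd n then int (card (T' (n div s))) else 0)"
    using assms(3) by (auto split: if_splits)
  then have "int (card (T_set s c n)) - (int s - 1) * int (card (U_set s c n)) =
      (if s dvd n then int (card (T' (n div s))) else 0)"
    by (simp only: S T'_eq[OF assms(3)])
  moreover have "T' (n div s) = T_set s c (n div s)" if dvd: "s dvd n" and ne: "n \<noteq> s"
  proof (rule T'_eq)
    obtain k where k: "n = s * k"
      using dvd by blast
    then have "k \<noteq> 0" "k \<noteq> 1"
      using ne assms(3) by (auto intro: gr0I)
    with k s0 show "n div s \<ge> 2"
      by simp
  qed
  moreover have "n div s = 1" if "n = s"
    using that s0 by simp
  ultimately show ?thesis
    using T'_1 by (cases "s dvd n"; cases "n = s") (simp_all del: One_nat_def)
qed

end
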